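(* Let $\Omega$ be a divisible ML-algebra, let $\alpha:A$ and $\beta:B$ be $\Omega$-sets, let $f:A\rightharpoonup B$ be a multi-morphism that is total in $\alpha:A$ and faithful in $\beta:B$, and let $a$ and $b$ be observable descriptions of entities in $\alpha:A$ and $\beta:B$, respectively. Then the equations 1. $[a]_\alpha\otimes f(\beta|a)=f(a,\_)$ in the unknown $f(\beta|a):B\to\Omega$, and 2. $[b]_\beta\otimes f(\alpha|b)=f(\_,b)$ in the unknown $f(\alpha|b):A\to\Omega$ (both understood pointwise) have a solution, and they define $\Omega$-maps $f(\beta|a):B\to\Omega$ and $f(\alpha|b):A\to\Omega$ given by $$f(\beta|a)=\big([a]_\alpha\Rightarrow f(a,\_)\big),\qquad f(\alpha|b)=\big([b]_\beta\Rightarrow f(\_,b)\big).$$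
   Context: An ML-algebra is a system $(\Omega,\otimes,\Rightarrow,\vee,\wedge,\bot,\top)$ such that $(\Omega,\otimes,\top)$ is a commutative monoid, $(\Omega,\vee,\wedge,\bot,\top)$ is a bounded lattice, and $x\le (y\Rightarrow z)$ iff $x\otimes y\le z$ for all $x,y,z$. The lattice is assumed complete and $\top\ne\bot$. It is divisible if $x\otimes(x\Rightarrow y)=x\wedge y$ for all $x,y$. An $\Omega$-set $\alpha:A$ is a set $A$ with a map $[\cdot=\cdot]_\alpha:A\times A\to\Omega$ satisfying $[x=y]_\alpha=[y=x]_\alpha$ and $[x=y]_\alpha\otimes[y=z]_\alpha\le[x=z]_\alpha$. The extent of $x\in A$ is $[x]_\alpha=[x=x]_\alpha$. A multi-morphism $f:A\rightharpoonup B$ is a map $f:A\times B\to\Omega$. It is total in $\alpha:A$ if $[x]_\alpha=\bigvee_{y\in B}f(x,y)$ for every $x\in A$, and faithful in $\beta:B$ if $[y]_\beta=\bigvee_{x\in A}f(x,y)$ for every $y\in B$. Observable descriptions: if $A=\prod_{i\in I}A_i$ and a subset $L\subseteq I$ of attributes is declared observable, an observable description of an entity in $\alpha:A$ is an element $a\in\prod_{i\in L}A_i$. Write $x=(c,a)$ for an element $x\in A$ whose observable part is $a$. The similarity is extended to observable descriptions by $[a=a']_\alpha=\bigvee_{x=(c,a),\,y=(d,a')\in A}[x=y]_\alpha$, with $[a]_\alpha=[a=a]_\alpha$. The same applies to $\beta:B$. The map $f$ is extended to observable descriptions by taking joins over all elements with the given observable part: $f(a,y)=\bigvee_{x=(c,a)}f(x,y)$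 for $y\in B$, and $f(x,b)=\bigvee_{y=(d,b)}f(x,y)$ for $x\in A$. Then $f(a,\_):B\to\Omega$ is the map $y\mapsto f(a,y)$ and $f(\_,b):A\to\Omega$ is the map $x\mapsto f(x,b)$. *)

theory Defs
  imports "HOL-Library.FuncSet"
begin

locale ml_algebra =
  comm_monoid tensor top
  for tensor :: "'w :: complete_lattice \<Rightarrow> 'w \<Rightarrow> 'w" (infixl "\<otimes>" 70) +
  fixes residuum :: "'w \<Rightarrow> 'w \<Rightarrow> 'w" (infixr "\<leadsto>" 65)
  assumes residuation: "x \<le> (y \<leadsto> z) \<longleftrightarrow> x \<otimes> y \<le> z"
    and top_neq_bot: "(top :: 'w) \<noteq> bot"

locale divisible_ml_algebra = ml_algebra +
  assumes divisible: "x \<otimes> (x \<leadsto> y) = inf x y"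

text \<open>
  Similarities and multi-morphisms are curried functions on whole types; only their values on
  the carrier sets are ever constrained or used.
\<close>

definition omega_set ::
  "('w \<Rightarrow> 'w \<Rightarrow> 'w) \<Rightarrow> 'a set \<Rightarrow> ('a \<Rightarrow> 'a \<Rightarrow> 'w :: complete_lattice) \<Rightarrow> bool" where
  "omega_set tensor A \<alpha> \<longleftrightarrow>
     (\<forall>x\<in>A. \<forall>y\<in>A. \<alpha> x y = \<alpha> y x) \<and>
     (\<forall>x\<in>A. \<forall>y\<in>A. \<forall>z\<in>A. tensor (\<alpha> x y) (\<alpha> y z) \<le> \<alpha> x z)"

definition extent :: "('a \<Rightarrow> 'a \<Rightarrow> 'w) \<Rightarrow> 'a \<Rightarrow> 'w" where
  "extent \<alpha> x = \<alpha> x x"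

definition total_in ::
  "'a set \<Rightarrow> ('a \<Rightarrow> 'a \<Rightarrow> 'w) \<Rightarrow> 'b set \<Rightarrow> ('a \<Rightarrow> 'b \<Rightarrow> 'w :: complete_lattice) \<Rightarrow> bool" where
  "total_in A \<alpha> B f \<longleftrightarrow> (\<forall>x\<in>A. extent \<alpha> x = (SUP y\<in>B. f x y))"

definition faithful_in ::
  "'a set \<Rightarrow> 'b set \<Rightarrow> ('b \<Rightarrow> 'b \<Rightarrow> 'w) \<Rightarrow> ('a \<Rightarrow> 'b \<Rightarrow> 'w :: complete_lattice) \<Rightarrow> bool" where
  "faithful_in A B \<beta> f \<longleftrightarrow> (\<forall>y\<in>B. extent \<beta> y = (SUP x\<in>A. f x y))"

text \<open>
  An entity is an extensional function on the attribute set \<open>I\<close>, so its observable part is its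
  restriction to \<open>L \<subseteq> I\<close>. The set below consists of the entities of the form \<open>(c, a)\<close>.
\<close>

definition described_by ::
  "('i \<Rightarrow> 'v) set \<Rightarrow> 'i set \<Rightarrow> ('i \<Rightarrow> 'v) \<Rightarrow> ('i \<Rightarrow> 'v) set" where
  "described_by A L a = {x \<in> A. restrict x L = a}"

definition desc_sim ::
  "('i \<Rightarrow> 'v) set \<Rightarrow> 'i set \<Rightarrow> (('i \<Rightarrow> 'v) \<Rightarrow> ('i \<Rightarrow> 'v) \<Rightarrow> 'w :: complete_lattice)
     \<Rightarrow> ('i \<Rightarrow> 'v) \<Rightarrow> ('i \<Rightarrow> 'v) \<Rightarrow> 'w" where
  "desc_sim A L \<alpha> a a' = (SUP (x, y)\<in>described_by A L a \<times> described_by A L a'. \<alpha> x y)"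

definition desc_extent ::
  "('i \<Rightarrow> 'v) set \<Rightarrow> 'i set \<Rightarrow> (('i \<Rightarrow> 'v) \<Rightarrow> ('i \<Rightarrow> 'v) \<Rightarrow> 'w :: complete_lattice)
     \<Rightarrow> ('i \<Rightarrow> 'v) \<Rightarrow> 'w" where
  "desc_extent A L \<alpha> a = desc_sim A L \<alpha> a a"

definition source_desc_map ::
  "('i \<Rightarrow> 'v) set \<Rightarrow> 'i set \<Rightarrow> (('i \<Rightarrow> 'v) \<Rightarrow> 'b \<Rightarrow> 'w :: complete_lattice)
     \<Rightarrow> ('i \<Rightarrow> 'v) \<Rightarrow> 'b \<Rightarrow> 'w" where
  "source_desc_map A L f a y = (SUP x\<in>described_by A L a. f x y)"

definition target_desc_map ::
  "('j \<Rightarrow> 'u) set \<Rightarrow> 'j set \<Rightarrow> ('a \<Rightarrow> ('j \<Rightarrow> 'u) \<Rightarrow> 'w :: complete_lattice)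
     \<Rightarrow> ('j \<Rightarrow> 'u) \<Rightarrow> 'a \<Rightarrow> 'w" where
  "target_desc_map B M f b x = (SUP y\<in>described_by B M b. f x y)"

end

theory Submission imports Defs
begin

text \<open>
  By totality and faithfulness, \<open>f\<close> is bounded by the extents of both of its arguments, and
  taking joins over the entities with a given observable part preserves these bounds. In a
  divisible algebra, \<open>x \<otimes> (x \<leadsto> y) = y\<close> whenever \<open>y \<le> x\<close>.
\<close>

lemma (in divisible_ml_algebra) tensor_residuum_eq:
  "y \<le> x \<Longrightarrow> x \<otimes> (x \<leadsto> y) = y"
  by (simp add: divisible inf_absorb2)

text \<open>The diagonal pair \<open>(x, x)\<close> is among the pairs joined in
  \<open>desc_sim A L \<alpha> a a\<close>. This turns a bound by the extent of one entity into a
  bound that is uniform over all entities described by \<open>a\<close>.\<close>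

lemma extent_le_desc_extent:
  assumes "x \<in> described_by A L a"
  shows "extent \<alpha> x \<le> desc_extent A L \<alpha> a"
  unfolding extent_def desc_extent_def desc_sim_def
  using assms by (intro SUP_upper2[of "(x, x)"]) auto

lemma source_desc_map_le_desc_extent:
  assumes "total_in A \<alpha> B f" and "y \<in> B"
  shows "source_desc_map A L f a y \<le> desc_extent A L \<alpha> a"
  unfolding source_desc_map_def
proof (rule SUP_least)
  fix x assume x: "x \<in> described_by A L a"
  then have "x \<in> A" by (simp add: described_by_def)
  \<comment> \<open>Totality makes the extent of \<open>x\<close> a join over \<open>B\<close>, and
    \<open>f x y\<close> is one of its members.\<close>
  then have "f x y \<le> extent \<alpha> x"
    using assms by (auto simp: total_in_def intro: SUP_upper)
  also have "\<dots> \<le> desc_extent A L \<alpha> a"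
    using x by (rule extent_le_desc_extent)
  finally show "f x y \<le> desc_extent A L \<alpha> a" .
qed

text \<open>Faithfulness of \<open>f\<close> is totality of its transpose, and transposition turns
  the target extension into the source extension, so the previous bound applies.\<close>

lemma target_desc_map_le_desc_extent:
  assumes "faithful_in A B \<beta> f" and "x \<in> A"
  shows "target_desc_map B M f b x \<le> desc_extent B M \<beta> b"
proof -
  have "total_in B \<beta> A (\<lambda>y x. f x y)"
    using assms(1) by (simp add: total_in_def faithful_in_def)
  then have "source_desc_map B M (\<lambda>y x. f x y) b x \<le> desc_extent B M \<beta> b"
    using assms(2) by (rule source_desc_map_le_desc_extent)
  then show ?thesis
    by (simp add: source_desc_map_def target_desc_map_def)
qed

text \<open>Solutions need not be unique: if the extent of the description is \<open>bot\<close>,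
  every map is one. By \<open>residuation\<close> the residuum is the greatest solution; the second
  and fourth conjuncts single it out.\<close>

theorem proposition4:
  fixes tensor :: "'w :: complete_lattice \<Rightarrow> 'w \<Rightarrow> 'w" (infixl "\<otimes>" 70)
    and residuum :: "'w \<Rightarrow> 'w \<Rightarrow> 'w" (infixr "\<leadsto>" 65)
    and I :: "'i set" and As :: "'i \<Rightarrow> 'v set" and L :: "'i set"
    and J :: "'j set" and Bs :: "'j \<Rightarrow> 'u set" and M :: "'j set"
    and A :: "('i \<Rightarrow> 'v) set" and B :: "('j \<Rightarrow> 'u) set"
    and \<alpha> :: "('i \<Rightarrow> 'v) \<Rightarrow> ('i \<Rightarrow> 'v) \<Rightarrow> 'w"
    and \<beta> :: "('j \<Rightarrow> 'u) \<Rightarrow> ('j \<Rightarrow> 'u) \<Rightarrow> 'w"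
    and f :: "('i \<Rightarrow> 'v) \<Rightarrow> ('j \<Rightarrow> 'u) \<Rightarrow> 'w"
    and a :: "'i \<Rightarrow> 'v" and b :: "'j \<Rightarrow> 'u"
  assumes "divisible_ml_algebra (\<otimes>) (\<leadsto>)"
    and "A = (\<Pi>\<^sub>E i\<in>I. As i)" and "L \<subseteq> I"
    and "B = (\<Pi>\<^sub>E j\<in>J. Bs j)" and "M \<subseteq> J"
    and "omega_set (\<otimes>) A \<alpha>" and "omega_set (\<otimes>) B \<beta>"
    and "total_in A \<alpha> B f" and "faithful_in A B \<beta> f"
    and "a \<in> (\<Pi>\<^sub>E i\<in>L. As i)" and "b \<in> (\<Pi>\<^sub>E j\<in>M. Bs j)"
  shows "(\<exists>g. \<forall>y\<in>B. desc_extent A L \<alpha> a \<otimes> g y = source_desc_map A L f a y)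
    \<and> (\<forall>y\<in>B. desc_extent A L \<alpha> a \<otimes> (desc_extent A L \<alpha> a \<leadsto> source_desc_map A L f a y)
              = source_desc_map A L f a y)
    \<and> (\<exists>h. \<forall>x\<in>A. desc_extent B M \<beta> b \<otimes> h x = target_desc_map B M f b x)
    \<and> (\<forall>x\<in>A. desc_extent B M \<beta> b \<otimes> (desc_extent B M \<beta> b \<leadsto> target_desc_map B M f b x)
              = target_desc_map B M f b x)"
proof -
  interpret divisible_ml_algebra tensor residuum by fact
  have source: "\<forall>y\<in>B. desc_extent A L \<alpha> a \<otimes>
      (desc_extent A L \<alpha> a \<leadsto> source_desc_map A L f a y) = source_desc_map A L f a y"
    using source_desc_map_le_desc_extent[OF \<open>total_in A \<alpha> B f\<close>]
    by (blast intro: tensor_residuum_eq)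
  have target: "\<forall>x\<in>A. desc_extent B M \<beta> b \<otimes>
      (desc_extent B M \<beta> b \<leadsto> target_desc_map B M f b x) = target_desc_map B M f b x"
    using target_desc_map_le_desc_extent[OF \<open>faithful_in A B \<beta> f\<close>]
    by (blast intro: tensor_residuum_eq)
  \<comment> \<open>\<open>exI\<close> leaves \<open>g\<close> and \<open>h\<close> schematic;
    unification with \<open>source\<close> and \<open>target\<close> instantiates them with the
    residua.\<close>
  show ?thesis
    by (intro conjI exI) (fact source target)+
qed

end
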